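(* Let $A_1=C_7(1,2)$ and $A_2=\overline{C_3+C_4}$. For every $n\ge 2$, $\chi_{la}(A_1\vee O_{2n-1})=5$ and $\chi_{la}(A_2\vee O_{2n-1})=4$.
   Context: $C_7(1,2)$ is the circulant graph on $\mathbb{Z}_7$ in which $i,j$ are adjacent iff their cyclic distance is 1 or 2. $\overline{C_3+C_4}$ is the complement of the disjoint union of a 3-cycle and a 4-cycle. $O_n$ is the edgeless graph on $n$ vertices, and the join $G\vee H$ of vertex-disjoint graphs has vertex set $V(G)\cup V(H)$ and edge set $E(G)\cup E(H)\cup\{uv:u\in V(G),v\in V(H)\}$. For a simple graph with $q$ edges, a bijection $f:E\to\{1,\dots,q\}$ is a local antimagic labeling if $f^+(u)\neq f^+(v)$ for every edge $uv$, where $f^+(u)=\sum_{e\ni u} f(e)$; $\chi_{la}$ is the minimum number of distinct values of $f^+$ over all local antimagic labelings. *)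

theory Defs
  imports Main
begin

record 'a ugraph =
  verts :: "'a set"
  edges :: "'a set set"

definition simple_graph :: "'a ugraph \<Rightarrow> bool" where
  "simple_graph G \<longleftrightarrow> finite (verts G) \<and> (\<forall>e \<in> edges G. e \<subseteq> verts G \<and> card e = 2)"

definition cyclic_distance :: "nat \<Rightarrow> nat \<Rightarrow> nat \<Rightarrow> nat" where
  "cyclic_distance n i j = min (max i j - min i j) (n - (max i j - min i j))"

definition circulant_graph :: "nat \<Rightarrow> nat set \<Rightarrow> nat ugraph" where
  "circulant_graph n S =
    \<lparr> verts = {0..<n},
      edges = {{i, j} | i j. i < n \<and> j < n \<and> i \<noteq> j \<and> cyclic_distance n i j \<in> S} \<rparr>"

definition cycle_graph :: "nat \<Rightarrow> nat ugraph" where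
  "cycle_graph n = \<lparr> verts = {0..<n}, edges = {{i, (i + 1) mod n} | i. i < n} \<rparr>"

definition edgeless_graph :: "nat \<Rightarrow> nat ugraph" where
  "edgeless_graph n = \<lparr> verts = {0..<n}, edges = {} \<rparr>"

definition complement_graph :: "'a ugraph \<Rightarrow> 'a ugraph" where
  "complement_graph G =
    \<lparr> verts = verts G,
      edges = {{u, v} | u v. u \<in> verts G \<and> v \<in> verts G \<and> u \<noteq> v \<and> {u, v} \<notin> edges G} \<rparr>"

text \<open>Vertex-disjointness in disjoint unions and joins is realised by tagging the
  vertices of the two graphs with the injections of the sum type.\<close>

definition disjoint_union_graph :: "'a ugraph \<Rightarrow> 'b ugraph \<Rightarrow> ('a + 'b) ugraph" where
  "disjoint_union_graph G H =
    \<lparr> verts = Inl ` verts G \<union> Inr ` verts H,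
      edges = (image Inl) ` edges G \<union> (image Inr) ` edges H \<rparr>"

definition join_graph :: "'a ugraph \<Rightarrow> 'b ugraph \<Rightarrow> ('a + 'b) ugraph" where
  "join_graph G H =
    \<lparr> verts = Inl ` verts G \<union> Inr ` verts H,
      edges = (image Inl) ` edges G \<union> (image Inr) ` edges H
              \<union> {{Inl u, Inr v} | u v. u \<in> verts G \<and> v \<in> verts H} \<rparr>"

definition vertex_sum :: "'a ugraph \<Rightarrow> ('a set \<Rightarrow> nat) \<Rightarrow> 'a \<Rightarrow> nat" where
  "vertex_sum G f u = (\<Sum>e | e \<in> edges G \<and> u \<in> e. f e)"

definition local_antimagic_labeling :: "'a ugraph \<Rightarrow> ('a set \<Rightarrow> nat) \<Rightarrow> bool" where
  "local_antimagic_labeling G f \<longleftrightarrow>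
    bij_betw f (edges G) {1..card (edges G)} \<and>
    (\<forall>u v. {u, v} \<in> edges G \<longrightarrow> vertex_sum G f u \<noteq> vertex_sum G f v)"

text \<open>Intended for finite simple graphs. \<open>LEAST\<close> is unspecified if there is no local
  antimagic labeling, so the value is meaningful only when one exists.\<close>

definition chi_la :: "'a ugraph \<Rightarrow> nat" where
  "chi_la G =
    (LEAST k. \<exists>f. local_antimagic_labeling G f \<and> card (vertex_sum G f ` verts G) = k)"

definition A1 :: "nat ugraph" where
  "A1 = circulant_graph 7 {1, 2}"

definition A2 :: "(nat + nat) ugraph" where
  "A2 = complement_graph (disjoint_union_graph (cycle_graph 3) (cycle_graph 4))"

lemma simple_graph_join:
  assumes "simple_graph G" "simple_graph H"
  shows "simple_graph (join_graph G H)"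
  using assms unfolding simple_graph_def join_graph_def
  by (fastforce simp: card_image)

lemma simple_graph_edgeless: "simple_graph (edgeless_graph n)"
  by (simp add: simple_graph_def edgeless_graph_def)

lemma simple_graph_A1: "simple_graph A1"
  by (auto simp: simple_graph_def A1_def circulant_graph_def)

lemma simple_graph_A2: "simple_graph A2"
  by (auto simp: simple_graph_def A2_def complement_graph_def disjoint_union_graph_def
      cycle_graph_def)

end

theory Submission
  imports Defs
begin

text \<open>
  Vertex sums form a proper colouring, so the chromatic numbers 5 and 4 of the two joins are lower
  bounds. For the upper bounds let the number of vertices of the edgeless part be \<open>2 * h + 1\<close>.
  The 14 edges of \<open>A1\<close> or \<open>A2\<close> receive the labels \<open>1..14\<close>, and the cross edges
  the entries of a \<open>7 \<times> (2 * h + 1)\<close> matrix with constant column sums, whose rows fall into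
  groups of sizes 3, 2, 2 such that the row sums within a group differ by at most 2. These bounded
  differences do not depend on \<open>h\<close>, so one suitable labeling of the 14 edges evens them out on
  each colour class for all \<open>h\<close>. The seven rows consist of a nearly magic block of three rows and
  two pairs of rows filled with pairs of consecutive labels in alternating order.
\<close>

section \<open>The nearly magic block of three rows\<close>

text \<open>Surjectivity follows by counting, so for the matrices below only injectivity and the
  range have to be checked.\<close>

lemma bij_betw_atLeastLessThanI:
  fixes f :: "'a \<Rightarrow> nat"
  assumes "inj_on f A" "f ` A \<subseteq> {0..<k}" "card A = k"
  shows "bij_betw f A {0..<k}"
  using assms by (simp add: bij_betw_def card_image card_subset_eq)

text \<open>Row \<open>i\<close> runs through all labels of one residue class modulo 3, and every column has the
  same sum: the quotients by 3 form a Kotzig array, i.e. three permutations of \<open>{0..2 * h}\<close> with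
  constant pointwise sum.\<close>

definition kotzig_entry :: "nat \<Rightarrow> nat \<Rightarrow> nat \<Rightarrow> nat" where
  "kotzig_entry h i j =
    (if i = 0 then (if j \<le> h then 3 * (h - j) + 1 else 3 * j + 1)
     else if i = 1 then (if j \<le> h then 3 * (2 * h - j) + 2 else 3 * (j - h - 1) + 2)
     else (if j \<le> h then 6 * j else 3 * (4 * h + 1 - 2 * j)))"

text \<open>Permuting within columns keeps the column sums. Column \<open>k\<close> plus column \<open>h + k\<close> has row
  sums \<open>6h + 2, 6h + 1, 6h + 3\<close>, so swapping two rows for every other \<open>k\<close> makes these excesses
  cancel, while the remaining columns \<open>0\<close>, \<open>h\<close>, \<open>2 * h\<close> are placed as a Latin square
  of small, middle and large entries.\<close>

definition row_perm :: "nat \<Rightarrow> nat \<Rightarrow> nat \<Rightarrow> nat" where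
  "row_perm h j =
    (if j = h then id(0 := 2, 1 := 0, 2 := 1)
     else if j = 2 * h then id(0 := 2, 2 := 0)
     else if odd (if j \<le> h then j else j - h) then id(1 := 2, 2 := 1)
     else id)"

text \<open>The residue modulo 3 reveals the row. Within a row, columns up to \<open>h\<close> and
  columns beyond \<open>h\<close> have disjoint ranges: separated by size in rows 0 and 1, by parity
  in row 2.\<close>

lemma kotzig_entry_inj:
  assumes "i < 3" "i' < 3" "j < 2 * h + 1" "j' < 2 * h + 1"
    and "kotzig_entry h i j = kotzig_entry h i' j'"
  shows "i = i' \<and> j = j'"
proof -
  have mod3: "kotzig_entry h i j mod 3 = (if i = 0 then 1 else if i = 1 then 2 else 0)" for i j
    by (auto simp: kotzig_entry_def mod_Suc)
  have i: "i = i'"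
  proof -
    have "(if i = 0 then 1 else if i = 1 then 2 else 0 :: nat) = (if i' = 0 then 1 else if i' = 1 then 2 else 0)"
      unfolding mod3[of i j, symmetric] mod3[of i' j', symmetric] assms(5) ..
    with assms(1,2) show ?thesis
      by (simp split: if_splits)
  qed
  have "j = j'"
    using assms(3-5) unfolding i kotzig_entry_def by (simp split: if_splits) presburger+
  with i show ?thesis ..
qed

text \<open>Column \<open>k\<close> is matched with column \<open>h + k\<close>, the pairing for
  which row sums of the permuted Kotzig array are nearly constant; columns \<open>0\<close>,
  \<open>h\<close>, \<open>2 * h\<close> are left over.\<close>

lemma sum_paired:
  fixes F :: "nat \<Rightarrow> nat"
  assumes "h \<ge> 1"
  shows "(\<Sum>j<2 * h + 1. F j) = F 0 + F h + F (2 * h) + (\<Sum>k\<in>{1..<h}. F k + F (h + k))"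
proof -
  have s: "{..<2 * h + 1} = {0, h, 2 * h} \<union> ({1..<h} \<union> (+) h ` {1..<h})"
    using assms by (auto simp: image_iff)
  have "(\<Sum>j<2 * h + 1. F j) = sum F {0, h, 2 * h} + (sum F {1..<h} + sum F ((+) h ` {1..<h}))"
    unfolding s using assms by (subst sum.union_disjoint | force)+
  then show ?thesis
    using assms by (simp add: sum.reindex sum.distrib del: image_add_atLeastLessThan)
qed

text \<open>Here \<open>c\<close> is the average row sum: the entries \<open>0..6 * h + 2\<close>
  add up to \<open>3 * c\<close>. Whether row 1 or row 2 misses it by one depends on whether the
  number \<open>h - 1\<close> of column pairs is even.\<close>

lemma three_row_block_sums:
  assumes "h \<ge> 1"
  defines "T \<equiv> \<lambda>i j. kotzig_entry h (row_perm h j i) j"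
    and "c \<equiv> (2 * h + 1) * (3 * h + 1)"
  shows "bij_betw (\<lambda>(i, j). T i j) ({0..<3} \<times> {0..<2 * h + 1}) {0..<3 * (2 * h + 1)}"
    and "\<And>j. j < 2 * h + 1 \<Longrightarrow> T 0 j + T 1 j + T 2 j = 9 * h + 3"
    and "(\<Sum>j<2 * h + 1. T 0 j) = c + 1"
    and "(\<Sum>j<2 * h + 1. T 1 j) = (if odd h then c - 1 else c)"
    and "(\<Sum>j<2 * h + 1. T 2 j) = (if odd h then c else c - 1)"
proof -
  have perm: "row_perm h j i < 3" if "i < 3" for i j
    using that by (auto simp: row_perm_def)
  have inj_perm: "inj (row_perm h j)" for j
    by (auto simp: row_perm_def inj_def)
  show "bij_betw (\<lambda>(i, j). T i j) ({0..<3} \<times> {0..<2 * h + 1}) {0..<3 * (2 * h + 1)}"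
  proof (rule bij_betw_atLeastLessThanI)
    show "inj_on (\<lambda>(i, j). T i j) ({0..<3} \<times> {0..<2 * h + 1})"
    proof (rule inj_onI, clarify)
      fix i j i' j'
      assume "i \<in> {0..<3}" "i' \<in> {0..<3}" "j \<in> {0..<2 * h + 1}" "j' \<in> {0..<2 * h + 1}" "T i j = T i' j'"
      then have "row_perm h j i = row_perm h j' i' \<and> j = j'"
        unfolding T_def by (intro kotzig_entry_inj) (auto simp: perm)
      then show "i = i' \<and> j = j'"
        using inj_perm by (auto dest: injD)
    qed
    show "(\<lambda>(i, j). T i j) ` ({0..<3} \<times> {0..<2 * h + 1}) \<subseteq> {0..<3 * (2 * h + 1)}"
      by (auto simp: T_def kotzig_entry_def)
  qed simp
  show "T 0 j + T 1 j + T 2 j = 9 * h + 3" if "j < 2 * h + 1" for j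
    using that by (auto simp: T_def row_perm_def kotzig_entry_def)
  \<comment> \<open>The average is \<open>6 * h + 2\<close>. Rows 1 and 2 deviate from it by one in
    opposite directions, with signs alternating in \<open>k\<close>; the deviation of row 2 is put
    on the left to avoid truncated subtraction.\<close>
  have pair: "T 0 k + T 0 (h + k) = 6 * h + 2"
    "T 1 k + T 1 (h + k) = 6 * h + 1 + 2 * (k mod 2)"
    "T 2 k + T 2 (h + k) + 2 * (k mod 2) = 6 * h + 3" if "k \<in> {1..<h}" for k
    using that by (auto simp: T_def row_perm_def kotzig_entry_def odd_iff_mod_2_eq_one even_iff_mod_2_eq_zero)
  have alt: "(\<Sum>k\<in>{1..<h}. 2 * (k mod 2)) = (if odd h then h - 1 else h)"
    by (induction h) (auto simp: odd_iff_mod_2_eq_one sum.atLeastLessThan_Suc)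
  have ends: "T 0 0 + T 0 h + T 0 (2 * h) = 9 * h + 4"
    "T 1 0 + T 1 h + T 1 (2 * h) = 9 * h + 2"
    "T 2 0 + T 2 h + T 2 (2 * h) = 9 * h + 3"
    using assms(1) by (auto simp: T_def row_perm_def kotzig_entry_def)
  have c: "c = 9 * h + 3 + (h - 1) * (6 * h + 2)"
    using assms(1) by (cases h) (simp_all add: c_def algebra_simps)
  \<comment> \<open>All products are expressed through \<open>(h - 1) * (6 * h + 2)\<close>, the one
    occurring in \<open>c\<close>, so that what remains is linear.\<close>
  have mult: "(h - 1) * (6 * h + 2) = (h - 1) * (6 * h + 1) + (h - 1)"
    "(h - 1) * (6 * h + 3) = (h - 1) * (6 * h + 2) + (h - 1)"
    by (simp_all only: add_mult_distrib2 mult_1_right add.assoc one_add_one numeral_plus_one arith_simps)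
  have row0: "(\<Sum>k\<in>{1..<h}. T 0 k + T 0 (h + k)) = (h - 1) * (6 * h + 2)"
    using pair(1) by simp
  show "(\<Sum>j<2 * h + 1. T 0 j) = c + 1"
    unfolding sum_paired[OF assms(1)] row0 ends c by simp
  have row1: "(\<Sum>k\<in>{1..<h}. T 1 k + T 1 (h + k)) = (h - 1) * (6 * h + 1) + (if odd h then h - 1 else h)"
    unfolding alt[symmetric] using pair(2) by (simp add: sum.distrib sum_Suc)
  show "(\<Sum>j<2 * h + 1. T 1 j) = (if odd h then c - 1 else c)"
    unfolding sum_paired[OF assms(1)] row1 ends c mult using assms(1) by simp
  have row2: "(\<Sum>k\<in>{1..<h}. T 2 k + T 2 (h + k)) + (if odd h then h - 1 else h) = (h - 1) * (6 * h + 3)"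
    unfolding alt[symmetric] sum.distrib[symmetric] using pair(3) by simp
  show "(\<Sum>j<2 * h + 1. T 2 j) = (if odd h then c else c - 1)"
    unfolding sum_paired[OF assms(1)] ends c using row2[unfolded mult] assms(1) by (simp split: if_splits)
qed

text \<open>Exchanging rows 1 and 2 for even \<open>h\<close> makes the deviations from the average
  independent of parity. This is needed for a single labeling of the 14 edges to serve every
  \<open>h\<close>.\<close>

lemma three_row_matrix:
  assumes "h \<ge> 1"
  obtains T :: "nat \<Rightarrow> nat \<Rightarrow> nat" where
    "bij_betw (\<lambda>(i, j). T i j) ({0..<3} \<times> {0..<2 * h + 1}) {0..<3 * (2 * h + 1)}"
    "\<forall>j<2 * h + 1. T 0 j + T 1 j + T 2 j = 9 * h + 3"
    "(\<Sum>j<2 * h + 1. T 0 j) = (2 * h + 1) * (3 * h + 1) + 1"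
    "(\<Sum>j<2 * h + 1. T 1 j) = (2 * h + 1) * (3 * h + 1) - 1"
    "(\<Sum>j<2 * h + 1. T 2 j) = (2 * h + 1) * (3 * h + 1)"
proof (cases "odd h")
  case True
  note aux = three_row_block_sums[OF assms, unfolded if_P[OF True]]
  from aux(1) _ aux(3-5) show ?thesis by (rule that) (use aux(2) in blast)
next
  case False
  define T where "T i j = kotzig_entry h (row_perm h j i) j" for i j
  note aux = three_row_block_sums[OF assms, folded T_def, unfolded if_not_P[OF False]]
  define s :: "nat \<Rightarrow> nat" where "s = id(1 := 2, 2 := 1)"
  have "bij_betw (map_prod s id) ({0..<3} \<times> {0..<2 * h + 1}) ({0..<3} \<times> {0..<2 * h + 1})"
    by (rule bij_betw_byWitness[where f' = "map_prod s id"]) (auto simp: s_def)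
  from bij_betw_trans[OF this aux(1)]
  have "bij_betw (\<lambda>(i, j). T (s i) j) ({0..<3} \<times> {0..<2 * h + 1}) {0..<3 * (2 * h + 1)}"
    by (simp add: comp_def case_prod_unfold)
  moreover have "s 0 = 0" "s 1 = 2" "s 2 = 1" by (simp_all add: s_def)
  moreover have "T 0 j + T 2 j + T 1 j = 9 * h + 3" if "j < 2 * h + 1" for j
    using aux(2)[OF that] by simp
  ultimately show ?thesis
    using that[of "\<lambda>i. T (s i)"] aux(3-5) by simp
qed

section \<open>The matrix with seven rows\<close>

text \<open>Within each of the groups \<open>0..2\<close>, \<open>3..4\<close>, \<open>5..6\<close>
  the polynomials differ only in the constant term; these constants are what the labels of the 14
  edges compensate.\<close>

definition row_totals :: "nat \<Rightarrow> nat list" where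
  "row_totals h = [22 * (h * h) + 21 * h + 6, 22 * (h * h) + 21 * h + 4, 22 * (h * h) + 21 * h + 5,
     4 * (h * h) + 3 * h, 4 * (h * h) + 3 * h + 1, 12 * (h * h) + 11 * h + 2, 12 * (h * h) + 11 * h + 3]"

lemma atLeastLessThan_0_7: "{0..<7} = {0, 1, 2, 3, 4, 5, 6 :: nat}"
  by auto

text \<open>With \<open>m = 2 * h + 1\<close>, rows 3 and 4 use \<open>0..2 * m - 1\<close>, rows 5
  and 6 use \<open>2 * m..4 * m - 1\<close>, and the three-row block is shifted by
  \<open>4 * m\<close>. Consecutive pairs ascend in rows 3 and 4 and descend in rows 5 and 6, so
  their contributions to a column add up to a constant.\<close>

lemma seven_row_matrix:
  assumes "h \<ge> 1"
  obtains M :: "nat \<Rightarrow> nat \<Rightarrow> nat" where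
    "bij_betw (\<lambda>(i, j). M i j) ({0..<7} \<times> {0..<2 * h + 1}) {0..<7 * (2 * h + 1)}"
    "\<forall>j<2 * h + 1. (\<Sum>i\<in>{0..<7}. M i j) = 49 * h + 21"
    "\<forall>i\<in>{0..<7}. (\<Sum>j<2 * h + 1. M i j) = row_totals h ! i"
proof -
  obtain T :: "nat \<Rightarrow> nat \<Rightarrow> nat" where T: "bij_betw (\<lambda>(i, j). T i j) ({0..<3} \<times> {0..<2 * h + 1}) {0..<3 * (2 * h + 1)}"
    "\<forall>j<2 * h + 1. T 0 j + T 1 j + T 2 j = 9 * h + 3"
    "(\<Sum>j<2 * h + 1. T 0 j) = (2 * h + 1) * (3 * h + 1) + 1"
    "(\<Sum>j<2 * h + 1. T 1 j) = (2 * h + 1) * (3 * h + 1) - 1"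
    "(\<Sum>j<2 * h + 1. T 2 j) = (2 * h + 1) * (3 * h + 1)"
    using three_row_matrix[OF assms] .
  define M where "M i j = (if i < 3 then 4 * (2 * h + 1) + T i j
      else if i < 5 then 2 * j + (i + 1 + j) mod 2
      else 2 * (4 * h + 1 - j) + (i + 1 + j) mod 2)" for i j
  have T_less: "T i j < 3 * (2 * h + 1)" if "i < 3" "j < 2 * h + 1" for i j
    using bij_betw_apply[OF T(1), of "(i, j)"] that by simp
  have T_inj: "i = i' \<and> j = j'"
    if "T i j = T i' j'" "i < 3" "i' < 3" "j < 2 * h + 1" "j' < 2 * h + 1" for i j i' j'
    using inj_onD[OF bij_betw_imp_inj_on[OF T(1)], of "(i, j)" "(i', j')"] that by simp
  have low: "M i j < 4 * (2 * h + 1)" if "3 \<le> i" "j < 2 * h + 1" for i j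
    using that unfolding M_def by simp presburger
  have high: "4 * (2 * h + 1) \<le> M i j" if "i < 3" for i j
    using that by (simp add: M_def)
  have inj: "i = i' \<and> j = j'"
    if "M i j = M i' j'" "i < 7" "i' < 7" "j < 2 * h + 1" "j' < 2 * h + 1" for i j i' j'
  proof (cases "i < 3 \<or> i' < 3")
    case True
    then have small: "i < 3" "i' < 3"
      using low[of i j] low[of i' j'] high[of i j] high[of i' j'] that by linarith+
    then have "T i j = T i' j'" using that(1) by (simp add: M_def)
    then show ?thesis using T_inj small that(4,5) by blast
  next
    case False
    then have i: "i \<in> {3, 4, 5, 6}" "i' \<in> {3, 4, 5, 6}" using that by auto
    \<comment> \<open>Halving reveals the column and the pair of rows, because
      \<open>j \<le> 2 * h < 4 * h + 1 - j\<close>; the parity then singles out the row of the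
      pair.\<close>
    have half: "M i j div 2 = (if i < 5 then j else 4 * h + 1 - j)" if "3 \<le> i" for i j
      using that by (simp add: M_def)
    have par: "M i j mod 2 = (i + 1 + j) mod 2" if "3 \<le> i" for i j
      using that by (simp add: M_def)
    have halves: "(if i < 5 then j else 4 * h + 1 - j) = (if i' < 5 then j' else 4 * h + 1 - j')"
      and parity: "(i + 1 + j) mod 2 = (i' + 1 + j') mod 2"
      using half[of i j] half[of i' j'] par[of i j] par[of i' j'] False that(1) by simp_all
    have j: "j = j' \<and> (i < 5 \<longleftrightarrow> i' < 5)"
      using halves that(4,5) by (simp split: if_splits)
    have "even (i + 1 + j) \<longleftrightarrow> even (i' + 1 + j')"
      by (metis parity even_mod_2_iff)
    with j have "even i \<longleftrightarrow> even i'" by auto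
    with i j show ?thesis by auto
  qed
  have bij: "bij_betw (\<lambda>(i, j). M i j) ({0..<7} \<times> {0..<2 * h + 1}) {0..<7 * (2 * h + 1)}"
  proof (rule bij_betw_atLeastLessThanI)
    show "inj_on (\<lambda>(i, j). M i j) ({0..<7} \<times> {0..<2 * h + 1})"
      by (auto simp: inj_on_def dest: inj)
    have "M i j < 7 * (2 * h + 1)" if "j < 2 * h + 1" for i j
      using T_less[of i j] low[of i j] that by (cases "i < 3") (auto simp: M_def)
    then show "(\<lambda>(i, j). M i j) ` ({0..<7} \<times> {0..<2 * h + 1}) \<subseteq> {0..<7 * (2 * h + 1)}"
      by auto
  qed simp
  have col: "(\<Sum>i\<in>{0..<7}. M i j) = 49 * h + 21" if "j < 2 * h + 1" for j
  proof -
    have "M 3 j + M 4 j = 4 * j + 1" "M 5 j + M 6 j = 4 * (4 * h + 1 - j) + 1"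
      by (simp_all add: M_def) presburger+
    moreover have "M 0 j + M 1 j + M 2 j = 12 * (2 * h + 1) + (9 * h + 3)"
      using T(2)[rule_format, OF that] by (simp add: M_def)
    ultimately show ?thesis using that by (simp add: atLeastLessThan_0_7)
  qed
  have sum_id: "(\<Sum>j<2 * h + 1. 2 * j) = 4 * (h * h) + 2 * h"
    by (induction h) auto
  have sum_rev: "(\<Sum>j<2 * h + 1. 2 * (4 * h + 1 - j)) = 12 * (h * h) + 10 * h + 2"
  proof -
    have "(\<Sum>j<2 * h + 1. 2 * (4 * h + 1 - j)) + (\<Sum>j<2 * h + 1. 2 * j) = (\<Sum>j<2 * h + 1. 2 * (4 * h + 1))"
      unfolding sum.distrib[symmetric] by (rule sum.cong) auto
    then show ?thesis unfolding sum_id by (simp add: algebra_simps)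
  qed
  \<comment> \<open>Alternation leaves a difference of only one inside each pair of rows: among the
    columns \<open>0..2 * h\<close> there are \<open>h\<close> odd and \<open>h + 1\<close> even
    indices.\<close>
  have sum_even: "(\<Sum>j<2 * h + 1. j mod 2) = h" and sum_odd: "(\<Sum>j<2 * h + 1. Suc j mod 2) = h + 1"
    by (induction h) (auto simp: mod_Suc)
  have row: "(\<Sum>j<2 * h + 1. M i j) = row_totals h ! i" if "i \<in> {0..<7}" for i
  proof -
    have low_rows: "(\<Sum>j<2 * h + 1. M 0 j) = row_totals h ! 0" "(\<Sum>j<2 * h + 1. M 1 j) = row_totals h ! 1"
      "(\<Sum>j<2 * h + 1. M 2 j) = row_totals h ! 2"
      using T(3-5) by (simp_all add: M_def row_totals_def sum.distrib algebra_simps del: sum.lessThan_Suc)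
    have "M 3 j = 2 * j + j mod 2" "M 4 j = 2 * j + Suc j mod 2"
      "M 5 j = 2 * (4 * h + 1 - j) + j mod 2" "M 6 j = 2 * (4 * h + 1 - j) + Suc j mod 2" for j
      by (simp_all add: M_def) presburger+
    then have "(\<Sum>j<2 * h + 1. M 3 j) = row_totals h ! 3" "(\<Sum>j<2 * h + 1. M 4 j) = row_totals h ! 4"
      "(\<Sum>j<2 * h + 1. M 5 j) = row_totals h ! 5" "(\<Sum>j<2 * h + 1. M 6 j) = row_totals h ! 6"
      by (simp_all only: sum.distrib sum_id sum_rev sum_even sum_odd) (simp_all add: row_totals_def)
    with low_rows that show ?thesis
      unfolding atLeastLessThan_0_7 by auto
  qed
  with bij col show ?thesis using that by blast
qed

section \<open>Labelings of a join with an edgeless graph\<close>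

text \<open>Labeling edges by list position turns vertex sums into finite sums that can be evaluated
  on a concrete list.\<close>

lemma list_edge_labeling:
  assumes "distinct E" "set E = edges G"
  obtains g where "bij_betw g (edges G) {1..length E}"
    and "\<forall>u. vertex_sum G g u = (\<Sum>k<length E. if u \<in> E ! k then k + 1 else 0)"
proof
  let ?I = "{..<length E}"
  define g where "g = Suc \<circ> inv_into ?I ((!) E)"
  have nth: "bij_betw ((!) E) ?I (edges G)"
    using assms by (metis bij_betw_nth)
  have "bij_betw Suc ?I {1..length E}"
    by (auto simp: bij_betw_def lessThan_atLeast0)
  then show "bij_betw g (edges G) {1..length E}"
    unfolding g_def by (rule bij_betw_trans[OF bij_betw_inv_into[OF nth]])
  show "\<forall>u. vertex_sum G g u = (\<Sum>k<length E. if u \<in> E ! k then k + 1 else 0)"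
  proof
    fix u
    have fin: "finite (edges G)" using assms(2) by (metis List.finite_set)
    have "vertex_sum G g u = (\<Sum>e\<in>edges G. if u \<in> e then g e else 0)"
      unfolding vertex_sum_def using fin by (auto simp: sum.If_cases intro!: sum.cong)
    also have "\<dots> = (\<Sum>k<length E. if u \<in> E ! k then g (E ! k) else 0)"
      by (rule sum.reindex_bij_betw[OF nth, symmetric])
    also have "\<dots> = (\<Sum>k<length E. if u \<in> E ! k then k + 1 else 0)"
      using nth by (intro sum.cong) (auto simp: g_def bij_betw_inv_into_left)
    finally show "vertex_sum G g u = (\<Sum>k<length E. if u \<in> E ! k then k + 1 else 0)" .
  qed
qed

text \<open>Edges of \<open>G\<close> keep the labels \<open>1..q\<close> and cross edges take the
  matrix entries shifted by \<open>q + 1\<close>. Each cross edge thus contributes the extra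
  \<open>q + 1\<close> at both of its ends.\<close>

lemma join_edgeless_labeling:
  fixes G :: "'a ugraph"
  assumes g: "bij_betw g (edges G) {1..q}"
    and M: "bij_betw (\<lambda>(u, j). M u j) (verts G \<times> {0..<m}) {0..<k}"
  defines "J \<equiv> join_graph G (edgeless_graph m)"
  obtains f where "bij_betw f (edges J) {1..card (edges J)}"
    and "\<forall>u\<in>verts G. vertex_sum J f (Inl u) = vertex_sum G g u + (\<Sum>j<m. M u j) + m * (q + 1)"
    and "\<forall>j<m. vertex_sum J f (Inr j) = (\<Sum>u\<in>verts G. M u j) + card (verts G) * (q + 1)"
proof
  \<comment> \<open>A labeling is a function of edges as sets, so the two ends of a cross edge are
    recovered as the only elements of its preimages under \<open>Inl\<close> and
    \<open>Inr\<close>.\<close>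
  define f where "f e = (if e \<inter> range Inr = {} then g (Inl -` e)
      else q + 1 + M (the_elem (Inl -` e)) (the_elem (Inr -` e)))" for e
  define cross where "cross = (\<lambda>(u, j). {Inl u, Inr j}) ` (verts G \<times> {0..<m})"
  have J: "edges J = image Inl ` edges G \<union> cross"
    by (auto simp: J_def join_graph_def edgeless_graph_def cross_def)
  have f_Inl: "f (Inl ` e) = g e" for e
  proof -
    have "Inl -` (Inl ` e :: ('a + nat) set) = e" by auto
    moreover have "(Inl ` e :: ('a + nat) set) \<inter> range Inr = {}" by auto
    ultimately show ?thesis by (simp add: f_def)
  qed
  have f_cross: "f {Inl u, Inr j} = q + 1 + M u j" for u j
  proof -
    have "Inl -` {Inl u, Inr j} = {u}" "Inr -` {Inl u, Inr j} = {j}" by auto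
    moreover have "{Inl u, Inr j} \<inter> range Inr \<noteq> {}" by auto
    ultimately show ?thesis by (simp add: f_def)
  qed
  have inj_cross: "inj_on (\<lambda>(u, j). {Inl u, Inr j}) (verts G \<times> {0..<m})"
    by (auto simp: inj_on_def doubleton_eq_iff)
  have inj_Inl: "inj_on (image Inl) (edges G)"
    by (auto simp: inj_on_def inj_image_eq_iff)
  have b1: "bij_betw f (image Inl ` edges G) {1..q}"
  proof -
    have "bij_betw (f \<circ> image Inl) (edges G) {1..q}"
      using g by (simp add: f_Inl comp_def)
    then show ?thesis
      using bij_betw_comp_iff[OF inj_on_imp_bij_betw[OF inj_Inl]] by blast
  qed
  have b2: "bij_betw f cross {q + 1..<q + 1 + k}"
  proof -
    have "bij_betw ((+) (q + 1)) {0..<k} {q + 1..<q + 1 + k}"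
      by (rule bij_betw_byWitness[where f' = "\<lambda>x. x - (q + 1)"]) auto
    from bij_betw_trans[OF M this]
    have "bij_betw (f \<circ> (\<lambda>(u, j). {Inl u, Inr j})) (verts G \<times> {0..<m}) {q + 1..<q + 1 + k}"
      by (simp add: f_cross comp_def case_prod_unfold)
    then show ?thesis
      using bij_betw_comp_iff[OF inj_on_imp_bij_betw[OF inj_cross]] unfolding cross_def by blast
  qed
  have b: "bij_betw f (edges J) {1..q + k}"
  proof -
    have "{1..q} \<union> {q + 1..<q + 1 + k} = {1..q + k}" by auto
    moreover have "{1..q} \<inter> {q + 1..<q + 1 + k} = {}" by auto
    ultimately show ?thesis
      using bij_betw_combine[OF b1 b2] by (simp add: J)
  qed
  moreover have "card (edges J) = q + k"
    using bij_betw_same_card[OF b] by simp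
  ultimately show "bij_betw f (edges J) {1..card (edges J)}" by simp
  have finE: "finite (edges G)" using g bij_betw_finite by blast
  show "\<forall>u\<in>verts G. vertex_sum J f (Inl u) = vertex_sum G g u + (\<Sum>j<m. M u j) + m * (q + 1)"
  proof
    fix u assume u: "u \<in> verts G"
    have "{e \<in> edges J. Inl u \<in> e} =
        image Inl ` {e \<in> edges G. u \<in> e} \<union> (\<lambda>j. {Inl u, Inr j}) ` {..<m}"
      using u unfolding J cross_def by auto
    moreover have "image Inl ` {e \<in> edges G. u \<in> e} \<inter> (\<lambda>j. {Inl u, Inr j}) ` {..<m} = {}"
      by auto
    ultimately have "vertex_sum J f (Inl u) =
        sum f (image Inl ` {e \<in> edges G. u \<in> e}) + sum f ((\<lambda>j. {Inl u, Inr j}) ` {..<m})"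
      unfolding vertex_sum_def using finE by (simp add: sum.union_disjoint)
    moreover have "sum f (image Inl ` {e \<in> edges G. u \<in> e}) = vertex_sum G g u"
      unfolding vertex_sum_def
      by (subst sum.reindex[OF inj_on_subset[OF inj_Inl]]) (auto simp: f_Inl)
    moreover have "sum f ((\<lambda>j. {Inl u, Inr j}) ` {..<m}) = (\<Sum>j<m. M u j) + m * (q + 1)"
      by (subst sum.reindex) (auto simp: inj_on_def doubleton_eq_iff f_cross sum.distrib sum_Suc)
    ultimately show "vertex_sum J f (Inl u) = vertex_sum G g u + (\<Sum>j<m. M u j) + m * (q + 1)" by simp
  qed
  show "\<forall>j<m. vertex_sum J f (Inr j) = (\<Sum>u\<in>verts G. M u j) + card (verts G) * (q + 1)"
  proof (intro allI impI)
    fix j assume j: "j < m"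
    have "{e \<in> edges J. Inr j \<in> e} = (\<lambda>u. {Inl u, Inr j}) ` verts G"
      using j unfolding J cross_def by auto
    then have "vertex_sum J f (Inr j) = (\<Sum>u\<in>verts G. f {Inl u, Inr j})"
      unfolding vertex_sum_def by (simp add: sum.reindex inj_on_def doubleton_eq_iff)
    then show "vertex_sum J f (Inr j) = (\<Sum>u\<in>verts G. M u j) + card (verts G) * (q + 1)"
      by (simp add: f_cross sum.distrib sum_Suc)
  qed
qed

section \<open>Explicit edge lists of the two graphs\<close>

text \<open>The position of an edge in these lists is its label (counting from 1); the orders were found
  by computer search.\<close>

definition A1_edge_list :: "nat set list" where
  "A1_edge_list = [{0, 1}, {4, 5}, {1, 2}, {2, 3}, {2, 4}, {5, 6}, {3, 5}, {3, 4}, {0, 6},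
     {1, 6}, {0, 5}, {4, 6}, {0, 2}, {1, 3}]"

definition A2_edge_list :: "(nat + nat) set list" where
  "A2_edge_list = [{Inl 0, Inr 3}, {Inl 2, Inr 3}, {Inl 1, Inr 1}, {Inl 1, Inr 2}, {Inl 0, Inr 2},
     {Inl 2, Inr 2}, {Inl 2, Inr 0}, {Inl 1, Inr 0}, {Inr 1, Inr 3}, {Inl 0, Inr 0}, {Inl 0, Inr 1},
     {Inr 0, Inr 2}, {Inl 2, Inr 1}, {Inl 1, Inr 3}]"


lemma A1_edge_iff:
  "{i, j} \<in> edges A1 \<longleftrightarrow> i < 7 \<and> j < 7 \<and> i \<noteq> j \<and> cyclic_distance 7 i j \<in> {1, 2}"
  by (auto simp: A1_def circulant_graph_def doubleton_eq_iff cyclic_distance_def max.commute min.commute)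

lemma set_A1_edge_list: "set A1_edge_list = edges A1"
proof
  show "set A1_edge_list \<subseteq> edges A1"
    by (simp add: A1_edge_list_def A1_edge_iff cyclic_distance_def)
  show "edges A1 \<subseteq> set A1_edge_list"
  proof
    fix e assume e: "e \<in> edges A1"
    then obtain i j where ij: "e = {i, j}"
      by (auto simp: A1_def circulant_graph_def)
    have "i \<in> {0, 1, 2, 3, 4, 5, 6}" "j \<in> {0, 1, 2, 3, 4, 5, 6}"
      using e unfolding ij A1_edge_iff by auto
    with e show "e \<in> set A1_edge_list"
      unfolding ij A1_edge_iff
      by (elim insertE emptyE; simp add: cyclic_distance_def A1_edge_list_def insert_commute)
  qed
qed

lemma length_A1_edge_list: "length A1_edge_list = 14"
  by (simp add: A1_edge_list_def)

lemma distinct_A1_edge_list: "distinct A1_edge_list"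
  by (simp add: A1_edge_list_def doubleton_eq_iff)

lemma verts_A2: "verts A2 = {Inl 0, Inl 1, Inl 2, Inr 0, Inr 1, Inr 2, Inr 3}"
proof -
  have "{0..<3} = {0, 1, 2 :: nat}" "{0..<4} = {0, 1, 2, 3 :: nat}" by auto
  then show ?thesis
    by (simp add: A2_def complement_graph_def disjoint_union_graph_def cycle_graph_def insert_commute)
qed

lemma A2_edge_iff:
  "{u, v} \<in> edges A2 \<longleftrightarrow> u \<in> verts A2 \<and> v \<in> verts A2 \<and> u \<noteq> v \<and>
     {u, v} \<notin> {{Inl 0, Inl 1}, {Inl 1, Inl 2}, {Inl 2, Inl 0},
                {Inr 0, Inr 1}, {Inr 1, Inr 2}, {Inr 2, Inr 3}, {Inr 3, Inr 0}}"
proof -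
  have cycle: "edges (cycle_graph n) = (\<lambda>i. {i, (i + 1) mod n}) ` {0..<n}" for n
    by (auto simp: cycle_graph_def)
  have "{0..<3} = {0, 1, 2 :: nat}" "{0..<4} = {0, 1, 2, 3 :: nat}" by auto
  then have D: "edges (disjoint_union_graph (cycle_graph 3) (cycle_graph 4)) =
      {{Inl 0, Inl 1}, {Inl 1, Inl 2}, {Inl 2, Inl 0},
       {Inr 0, Inr 1}, {Inr 1, Inr 2}, {Inr 2, Inr 3}, {Inr 3, Inr 0}}"
    by (simp add: disjoint_union_graph_def cycle numeral_2_eq_2[symmetric] insert_commute)
  show ?thesis
    unfolding A2_def complement_graph_def D[symmetric]
    by (auto simp: doubleton_eq_iff insert_commute)
qed

lemma set_A2_edge_list: "set A2_edge_list = edges A2"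
proof
  show "set A2_edge_list \<subseteq> edges A2"
    by (simp add: A2_edge_list_def A2_edge_iff verts_A2 doubleton_eq_iff)
  show "edges A2 \<subseteq> set A2_edge_list"
  proof
    fix e assume e: "e \<in> edges A2"
    then obtain u v where uv: "e = {u, v}"
      by (auto simp: A2_def complement_graph_def)
    have "u \<in> {Inl 0, Inl 1, Inl 2, Inr 0, Inr 1, Inr 2, Inr 3}"
      "v \<in> {Inl 0, Inl 1, Inl 2, Inr 0, Inr 1, Inr 2, Inr 3}"
      using e unfolding uv A2_edge_iff verts_A2 by auto
    with e show "e \<in> set A2_edge_list"
      unfolding uv A2_edge_iff
      by (elim insertE emptyE; simp add: A2_edge_list_def insert_commute)
  qed
qed

lemma length_A2_edge_list: "length A2_edge_list = 14"
  by (simp add: A2_edge_list_def)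

lemma distinct_A2_edge_list: "distinct A2_edge_list"
  by (simp add: A2_edge_list_def doubleton_eq_iff)

section \<open>Reduction to a colouring of the seven vertices\<close>

text \<open>The list \<open>cs\<close> bounds the number of sums of \<open>f\<close> by
  \<open>k\<close>; the lower bound, applied to \<open>f\<close> itself, makes it exactly
  \<open>k\<close>, and applied to all labelings makes \<open>k\<close> the least value.\<close>

lemma chi_la_eqI:
  assumes "local_antimagic_labeling G f" "vertex_sum G f ` verts G \<subseteq> set cs" "length cs = k"
    and "\<And>f. local_antimagic_labeling G f \<Longrightarrow> k \<le> card (vertex_sum G f ` verts G)"
  shows "chi_la G = k"
  unfolding chi_la_def
proof (rule Least_equality)
  have "card (vertex_sum G f ` verts G) \<le> k"
    using card_mono[OF finite_set assms(2)] card_length[of cs] assms(3) by simp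
  with assms(1,4) show "\<exists>f. local_antimagic_labeling G f \<and> card (vertex_sum G f ` verts G) = k"
    by (meson le_antisym)
qed (use assms(4) in blast)

lemma verts_join_edgeless:
  "verts (join_graph G (edgeless_graph m)) = Inl ` verts G \<union> Inr ` {0..<m}"
  by (simp add: join_graph_def edgeless_graph_def)

lemma join_edgeless_edge_Inl:
  fixes G :: "'a ugraph"
  assumes "{u, v} \<in> edges G"
  shows "{Inl u, Inl v} \<in> edges (join_graph G (edgeless_graph m))"
  using imageI[OF assms, of "image (Inl :: 'a \<Rightarrow> 'a + nat)"] by (simp add: join_graph_def)

lemma join_edgeless_edge_Inr:
  assumes "u \<in> verts G" "j < m"
  shows "{Inl u, Inr j} \<in> edges (join_graph G (edgeless_graph m))"
proof -
  have "{Inl u, Inr j} \<in> {{Inl u, Inr v} | u v. u \<in> verts G \<and> v \<in> {0..<m}}"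
    using assms by fastforce
  then show ?thesis by (simp add: join_graph_def edgeless_graph_def)
qed

text \<open>Properness is required edge by edge in \<open>G\<close>, a form that can be evaluated on
  an explicit edge list; cross edges only need \<open>d\<close> to be a new colour.\<close>

lemma local_antimagic_joinI:
  assumes "bij_betw f (edges (join_graph G (edgeless_graph m))) {1..card (edges (join_graph G (edgeless_graph m)))}"
    and G: "simple_graph G"
    and col: "\<And>u. u \<in> verts G \<Longrightarrow> vertex_sum (join_graph G (edgeless_graph m)) f (Inl u) = c u"
      "\<And>j. j < m \<Longrightarrow> vertex_sum (join_graph G (edgeless_graph m)) f (Inr j) = d"
    and proper: "\<forall>e\<in>edges G. \<forall>u\<in>e. \<forall>v\<in>e. u \<noteq> v \<longrightarrow> c u \<noteq> c v"
    and d: "d \<notin> c ` verts G"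
  shows "local_antimagic_labeling (join_graph G (edgeless_graph m)) f"
  unfolding local_antimagic_labeling_def
proof (intro conjI allI impI)
  let ?J = "join_graph G (edgeless_graph m)"
  fix x y assume xy: "{x, y} \<in> edges ?J"
  have "x \<noteq> y"
    using xy simple_graph_join[OF G simple_graph_edgeless] by (fastforce simp: simple_graph_def)
  from xy consider e where "e \<in> edges G" "{x, y} = Inl ` e"
    | u j where "u \<in> verts G" "j < m" "{x, y} = {Inl u, Inr j}"
    by (auto simp: join_graph_def edgeless_graph_def)
  then show "vertex_sum ?J f x \<noteq> vertex_sum ?J f y"
  proof cases
    case (1 e)
    have "x \<in> Inl ` e" "y \<in> Inl ` e" using 1(2) by auto
    then obtain u v where uv: "x = Inl u" "y = Inl v" "u \<in> e" "v \<in> e" by blast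
    then have "u \<in> verts G" "v \<in> verts G" using G 1(1) by (auto simp: simple_graph_def)
    with uv proper 1(1) \<open>x \<noteq> y\<close> show ?thesis by (auto simp: col)
  next
    case (2 u j)
    then show ?thesis using d by (force simp: col doubleton_eq_iff)
  qed
qed (fact assms(1))

text \<open>The bijection \<open>r\<close> assigns matrix rows to vertices. With
  \<open>q = 14\<close> the shift is 15, whence \<open>30 * h + 15 = (2 * h + 1) * 15\<close> and
  \<open>49 * h + 126 = (49 * h + 21) + 7 * 15\<close>.\<close>

lemma join_edgeless_coloring:
  assumes G: "simple_graph G" and E: "distinct E" "set E = edges G" "length E = 14"
    and r: "bij_betw r (verts G) {0..<7}" and "h \<ge> 1"
  obtains f where
    "bij_betw f (edges (join_graph G (edgeless_graph (2 * h + 1))))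
       {1..card (edges (join_graph G (edgeless_graph (2 * h + 1))))}"
    "\<forall>u\<in>verts G. vertex_sum (join_graph G (edgeless_graph (2 * h + 1))) f (Inl u) =
       (\<Sum>k<14. if u \<in> E ! k then k + 1 else 0) + row_totals h ! r u + (30 * h + 15)"
    "\<forall>j<2 * h + 1.
       vertex_sum (join_graph G (edgeless_graph (2 * h + 1))) f (Inr j) = 49 * h + 126"
proof -
  obtain g where g: "bij_betw g (edges G) {1..14}"
    "\<forall>u. vertex_sum G g u = (\<Sum>k<14. if u \<in> E ! k then k + 1 else 0)"
    using list_edge_labeling[OF E(1,2), unfolded E(3)] .
  obtain M :: "nat \<Rightarrow> nat \<Rightarrow> nat" where M: "bij_betw (\<lambda>(i, j). M i j) ({0..<7} \<times> {0..<2 * h + 1}) {0..<7 * (2 * h + 1)}"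
    "\<forall>j<2 * h + 1. (\<Sum>i\<in>{0..<7}. M i j) = 49 * h + 21"
    "\<forall>i\<in>{0..<7}. (\<Sum>j<2 * h + 1. M i j) = row_totals h ! i"
    using seven_row_matrix[OF \<open>h \<ge> 1\<close>] .
  have "bij_betw (map_prod r id) (verts G \<times> {0..<2 * h + 1}) ({0..<7} \<times> {0..<2 * h + 1})"
    by (rule bij_betw_map_prod[OF r bij_betw_id])
  from bij_betw_trans[OF this M(1)]
  have M_bij: "bij_betw (\<lambda>(u, j). M (r u) j) (verts G \<times> {0..<2 * h + 1}) {0..<7 * (2 * h + 1)}"
    by (simp add: comp_def case_prod_unfold)
  obtain f where f:
    "bij_betw f (edges (join_graph G (edgeless_graph (2 * h + 1))))
       {1..card (edges (join_graph G (edgeless_graph (2 * h + 1))))}"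
    "\<forall>u\<in>verts G. vertex_sum (join_graph G (edgeless_graph (2 * h + 1))) f (Inl u) =
       vertex_sum G g u + (\<Sum>j<2 * h + 1. M (r u) j) + (2 * h + 1) * (14 + 1)"
    "\<forall>j<2 * h + 1. vertex_sum (join_graph G (edgeless_graph (2 * h + 1))) f (Inr j) =
       (\<Sum>u\<in>verts G. M (r u) j) + card (verts G) * (14 + 1)"
    using join_edgeless_labeling[OF g(1) M_bij] .
  show ?thesis
  proof (rule that[OF f(1)]; intro ballI allI impI)
    show "vertex_sum (join_graph G (edgeless_graph (2 * h + 1))) f (Inl u) =
        (\<Sum>k<14. if u \<in> E ! k then k + 1 else 0) + row_totals h ! r u + (30 * h + 15)"
      if "u \<in> verts G" for u
      using f(2) g(2) M(3) bij_betw_apply[OF r that] that by simp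
    show "vertex_sum (join_graph G (edgeless_graph (2 * h + 1))) f (Inr j) = 49 * h + 126"
      if "j < 2 * h + 1" for j
      using f(3)[rule_format, OF that] M(2)[rule_format, OF that]
      unfolding sum.reindex_bij_betw[OF r, where g = "\<lambda>i. M i j"] bij_betw_same_card[OF r] by simp
  qed
qed

section \<open>Lower bounds from proper colouring\<close>

lemma local_antimagic_neq:
  "local_antimagic_labeling G f \<Longrightarrow> {u, v} \<in> edges G \<Longrightarrow> vertex_sum G f u \<noteq> vertex_sum G f v"
  by (simp add: local_antimagic_labeling_def)

lemma sums_A1_join_ge:
  assumes "m \<ge> 1" and f: "local_antimagic_labeling (join_graph A1 (edgeless_graph m)) f"
  shows "5 \<le> card (vertex_sum (join_graph A1 (edgeless_graph m)) f ` verts (join_graph A1 (edgeless_graph m)))"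
proof -
  let ?J = "join_graph A1 (edgeless_graph m)"
  define x where "x i = vertex_sum ?J f (Inl i)" for i
  define y where "y = vertex_sum ?J f (Inr 0)"
  have verts: "verts A1 = {0..<7}" by (simp add: A1_def circulant_graph_def)
  have neq: "x i \<noteq> x j" if "{i, j} \<in> edges A1" for i j
    unfolding x_def using local_antimagic_neq[OF f join_edgeless_edge_Inl[OF that]] .
  have y: "y \<noteq> x i" if "i < 7" for i
    unfolding x_def y_def using local_antimagic_neq[OF f join_edgeless_edge_Inr, of i 0] that assms(1) verts
    by fastforce
  have edges: "{0, 1} \<in> edges A1" "{0, 2} \<in> edges A1" "{1, 2} \<in> edges A1" "{1, 3} \<in> edges A1"
    "{2, 3} \<in> edges A1" "{2, 4} \<in> edges A1" "{3, 4} \<in> edges A1" "{3, 5} \<in> edges A1"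
    "{4, 5} \<in> edges A1" "{4, 6} \<in> edges A1" "{5, 6} \<in> edges A1" "{0, 6} \<in> edges A1" "{1, 6} \<in> edges A1"
    by (simp_all add: A1_edge_iff cyclic_distance_def)
  note ne = edges[THEN neq]
  \<comment> \<open>\<open>A1\<close> is not 3-colourable: with only the colours of the triangle 0,
    1, 2, the triangles of consecutive vertices force 3, 4, 5, 6 to repeat the colours of 0, 1, 2,
    0, but 0 and 6 are adjacent.\<close>
  obtain i where i: "i \<in> {3, 4, 5, 6}" "x i \<notin> {x 0, x 1, x 2}"
  proof (rule ccontr)
    assume "\<not> thesis"
    with that have "x i \<in> {x 0, x 1, x 2}" if "i \<in> {3, 4, 5, 6}" for i using that by blast
    from this[of 3] this[of 4] this[of 5] this[of 6] show False using ne by auto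
  qed
  have "i < 7" using i(1) by auto
  then have "card {y, x i, x 0, x 1, x 2} = 5"
    using ne(1-3) i(2) y[of 0] y[of 1] y[of 2] y[of i] by simp
  moreover have "{y, x i, x 0, x 1, x 2} \<subseteq> vertex_sum ?J f ` verts ?J"
    using \<open>i < 7\<close> assms(1) unfolding x_def y_def verts_join_edgeless verts by auto
  moreover have "finite (vertex_sum ?J f ` verts ?J)"
    by (simp add: verts_join_edgeless verts)
  ultimately show ?thesis by (metis card_mono)
qed

lemma sums_A2_join_ge:
  assumes "m \<ge> 1" and f: "local_antimagic_labeling (join_graph A2 (edgeless_graph m)) f"
  shows "4 \<le> card (vertex_sum (join_graph A2 (edgeless_graph m)) f ` verts (join_graph A2 (edgeless_graph m)))"
proof -
  let ?J = "join_graph A2 (edgeless_graph m)"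
  define x where "x u = vertex_sum ?J f (Inl u)" for u
  define y where "y = vertex_sum ?J f (Inr 0)"
  have neq: "x u \<noteq> x v" if "{u, v} \<in> edges A2" for u v
    unfolding x_def using local_antimagic_neq[OF f join_edgeless_edge_Inl[OF that]] .
  have y: "y \<noteq> x u" if "u \<in> verts A2" for u
    unfolding x_def y_def using local_antimagic_neq[OF f join_edgeless_edge_Inr, of u 0] that assms(1)
    by fastforce
  \<comment> \<open>Opposite vertices of the 4-cycle are adjacent in the complement; with a vertex
    of the 3-cycle and one of the edgeless part they form a 4-clique.\<close>
  have "{Inl 0, Inr 0} \<in> edges A2" "{Inl 0, Inr 2} \<in> edges A2" "{Inr 0, Inr 2} \<in> edges A2"
    by (simp_all add: A2_edge_iff verts_A2 doubleton_eq_iff)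
  note ne = this[THEN neq]
  have "card {y, x (Inl 0), x (Inr 0), x (Inr 2)} = 4"
    using ne y[of "Inl 0"] y[of "Inr 0"] y[of "Inr 2"] by (simp add: verts_A2)
  moreover have "{y, x (Inl 0), x (Inr 0), x (Inr 2)} \<subseteq> vertex_sum ?J f ` verts ?J"
    using assms(1) unfolding x_def y_def verts_join_edgeless verts_A2 by auto
  moreover have "finite (vertex_sum ?J f ` verts ?J)"
    by (simp add: verts_join_edgeless verts_A2)
  ultimately show ?thesis by (metis card_mono)
qed

section \<open>Labelings attaining the lower bounds\<close>

lemma chi_la_A1_join:
  assumes "h \<ge> 1"
  shows "chi_la (join_graph A1 (edgeless_graph (2 * h + 1))) = 5"
proof -
  \<comment> \<open>The colour classes are \<open>{0, 3}\<close>, \<open>{1, 4}\<close>,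
    \<open>{2, 5}\<close>, \<open>{6}\<close>. The first two receive the pairs of rows; the
    three-row block is split, rows 0 and 2 going to \<open>{2, 5}\<close> and row 1 to the single
    vertex 6.\<close>
  define r where "r u = [3, 5, 0, 4, 6, 2, 1 :: nat] ! u" for u
  define c0 where "c0 = 4 * (h * h) + 33 * h + 49"
  define c1 where "c1 = 12 * (h * h) + 41 * h + 45"
  define c2 where "c2 = 22 * (h * h) + 51 * h + 46"
  define c3 where "c3 = 22 * (h * h) + 51 * h + 56"
  define d where "d = 49 * h + 126"
  have verts: "verts A1 = {0, 1, 2, 3, 4, 5, 6}"
    by (simp add: A1_def circulant_graph_def atLeastLessThan_0_7)
  have r: "bij_betw r (verts A1) {0..<7}"
    unfolding verts by (auto simp: bij_betw_def inj_on_def r_def)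
  obtain f where f: "bij_betw f (edges (join_graph A1 (edgeless_graph (2 * h + 1))))
       {1..card (edges (join_graph A1 (edgeless_graph (2 * h + 1))))}"
    "\<forall>u\<in>verts A1. vertex_sum (join_graph A1 (edgeless_graph (2 * h + 1))) f (Inl u) =
       (\<Sum>k<14. if u \<in> A1_edge_list ! k then k + 1 else 0) + row_totals h ! r u + (30 * h + 15)"
    "\<forall>j<2 * h + 1. vertex_sum (join_graph A1 (edgeless_graph (2 * h + 1))) f (Inr j) = d"
    unfolding d_def
    using join_edgeless_coloring[OF simple_graph_A1 distinct_A1_edge_list set_A1_edge_list length_A1_edge_list r assms] .
  define c where "c u = [c0, c1, c2, c0, c1, c2, c3] ! u" for u
  have sums: "vertex_sum (join_graph A1 (edgeless_graph (2 * h + 1))) f (Inl u) = c u" if "u \<in> verts A1" for u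
    unfolding f(2)[rule_format, OF that] using that unfolding verts
    by (elim insertE emptyE)
      (simp_all add: A1_edge_list_def c_def r_def row_totals_def c0_def c1_def c2_def c3_def eval_nat_numeral)
  have less: "c0 < c1" "c1 < c2" "c2 < c3"
    using assms by (simp_all add: c0_def c1_def c2_def c3_def)
  \<comment> \<open>With \<open>h * h\<close> treated as an atom, \<open>d\<close> differs from
    \<open>c0\<close> and \<open>c1\<close> by an odd number, while \<open>d = c2\<close> or
    \<open>d = c3\<close> would give \<open>11 * (h * h) + h\<close> the value 40 or 35, which both
    cases exclude.\<close>
  have "h = 1 \<or> 4 \<le> h * h"
    using assms mult_le_mono[of 2 h 2 h] by linarith
  then have d: "d \<noteq> c0" "d \<noteq> c1" "d \<noteq> c2" "d \<noteq> c3"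
    unfolding d_def c0_def c1_def c2_def c3_def by presburger+
  have "local_antimagic_labeling (join_graph A1 (edgeless_graph (2 * h + 1))) f"
  proof (rule local_antimagic_joinI[OF f(1) simple_graph_A1 sums f(3)[rule_format]])
    show "\<forall>e\<in>edges A1. \<forall>u\<in>e. \<forall>v\<in>e. u \<noteq> v \<longrightarrow> c u \<noteq> c v"
      using less unfolding set_A1_edge_list[symmetric] A1_edge_list_def by (simp add: c_def)
    show "d \<notin> c ` verts A1"
      using d unfolding verts by (simp add: c_def)
  qed
  moreover have "vertex_sum (join_graph A1 (edgeless_graph (2 * h + 1))) f `
      verts (join_graph A1 (edgeless_graph (2 * h + 1))) \<subseteq> set [c0, c1, c2, c3, d]"
    unfolding verts_join_edgeless using sums f(3) by (auto simp: verts c_def)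
  ultimately show ?thesis
    by (rule chi_la_eqI) (simp_all add: sums_A1_join_ge)
qed

lemma chi_la_A2_join:
  assumes "h \<ge> 1"
  shows "chi_la (join_graph A2 (edgeless_graph (2 * h + 1))) = 4"
proof -
  \<comment> \<open>Cliques of the disjoint union become colour classes of its complement: the
    3-cycle takes the three-row block, and the edges \<open>{0, 1}\<close> and \<open>{2, 3}\<close>
    of the 4-cycle take the pairs of rows.\<close>
  define r :: "nat + nat \<Rightarrow> nat" where "r = case_sum id (\<lambda>i. i + 3)"
  define c0 where "c0 = 22 * (h * h) + 51 * h + 48"
  define c1 where "c1 = 4 * (h * h) + 33 * h + 52"
  define c2 where "c2 = 12 * (h * h) + 41 * h + 44"
  define d where "d = 49 * h + 126"
  have r: "bij_betw r (verts A2) {0..<7}"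
    unfolding verts_A2 by (auto simp: bij_betw_def inj_on_def r_def)
  obtain f where f: "bij_betw f (edges (join_graph A2 (edgeless_graph (2 * h + 1))))
       {1..card (edges (join_graph A2 (edgeless_graph (2 * h + 1))))}"
    "\<forall>u\<in>verts A2. vertex_sum (join_graph A2 (edgeless_graph (2 * h + 1))) f (Inl u) =
       (\<Sum>k<14. if u \<in> A2_edge_list ! k then k + 1 else 0) + row_totals h ! r u + (30 * h + 15)"
    "\<forall>j<2 * h + 1. vertex_sum (join_graph A2 (edgeless_graph (2 * h + 1))) f (Inr j) = d"
    unfolding d_def
    using join_edgeless_coloring[OF simple_graph_A2 distinct_A2_edge_list set_A2_edge_list length_A2_edge_list r assms] .
  define c where "c = case_sum (\<lambda>_ :: nat. c0) (\<lambda>i :: nat. if i < 2 then c1 else c2)"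
  have sums: "vertex_sum (join_graph A2 (edgeless_graph (2 * h + 1))) f (Inl u) = c u" if "u \<in> verts A2" for u
    unfolding f(2)[rule_format, OF that] using that unfolding verts_A2
    by (elim insertE emptyE)
      (simp_all add: A2_edge_list_def c_def r_def row_totals_def c0_def c1_def c2_def eval_nat_numeral)
  have less: "c1 < c2" "c2 < c0"
    unfolding c0_def c1_def c2_def using assms mult_le_mono[OF assms assms] by linarith+
  \<comment> \<open>Here \<open>d\<close> differs from \<open>c1\<close> and \<open>c2\<close> by 2
    modulo 4, and \<open>d = c0\<close> would mean \<open>11 * (h * h) + h = 39\<close>.\<close>
  have "h = 1 \<or> 4 \<le> h * h"
    using assms mult_le_mono[of 2 h 2 h] by linarith
  then have d: "d \<noteq> c0" "d \<noteq> c1" "d \<noteq> c2"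
    unfolding d_def c0_def c1_def c2_def by presburger+
  have "local_antimagic_labeling (join_graph A2 (edgeless_graph (2 * h + 1))) f"
  proof (rule local_antimagic_joinI[OF f(1) simple_graph_A2 sums f(3)[rule_format]])
    show "\<forall>e\<in>edges A2. \<forall>u\<in>e. \<forall>v\<in>e. u \<noteq> v \<longrightarrow> c u \<noteq> c v"
      using less unfolding set_A2_edge_list[symmetric] A2_edge_list_def by (simp add: c_def)
    show "d \<notin> c ` verts A2"
      using d unfolding verts_A2 by (simp add: c_def)
  qed
  moreover have "vertex_sum (join_graph A2 (edgeless_graph (2 * h + 1))) f `
      verts (join_graph A2 (edgeless_graph (2 * h + 1))) \<subseteq> set [c0, c1, c2, d]"
    unfolding verts_join_edgeless using sums f(3) by (auto simp: verts_A2 c_def)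
  ultimately show ?thesis
    by (rule chi_la_eqI) (simp_all add: sums_A2_join_ge)
qed

theorem theorem3p13:
  fixes n :: nat
  assumes "n \<ge> 2"
  shows "chi_la (join_graph A1 (edgeless_graph (2 * n - 1))) = 5 \<and>
         chi_la (join_graph A2 (edgeless_graph (2 * n - 1))) = 4"
proof -
  have "2 * n - 1 = 2 * (n - 1) + 1" "n - 1 \<ge> 1" using assms by auto
  then show ?thesis by (simp only: chi_la_A1_join chi_la_A2_join)
qed

end
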